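(* Let $N,q,t\ge 2$ and $w_1,\dots,w_t\ge 1$ be positive integers with $q\ge t$, and put $u=\sum_{i=1}^t w_i$. Let $1\le r\le u-1$ be the integer with $N\equiv r \pmod{u-1}$. Suppose there exists an $SHF(N;n,q,\{w_1,\ldots,w_t\})$. If $C(\lfloor N/(u-1)\rfloor,q,\{w_1,\ldots,w_t\})\ge u$, then $$n\le r\,q^{\lceil N/(u-1)\rceil}+(u-1-r)\,q^{\lfloor N/(u-1)\rfloor}.$$
   Context: An $(N;n,q)$-hash family is a set $\mathcal{F}$ of $N$ functions $f:X\to Y$ where $|X|=n$, $|Y|=q$. A function $f$ separates pairwise disjoint subsets $C_1,\dots,C_t\subseteq X$ if the images $f(C_1),\dots,f(C_t)$ are pairwise disjoint. An $(N;n,q)$-hash family is an $SHF(N;n,q,\{w_1,\ldots,w_t\})$ (separating hash family of type $\{w_1,\dots,w_t\}$) if for all pairwise disjoint $C_1,\dots,C_t\subseteq X$ with $|C_i|=w_i$ there is some $f\in\mathcal{F}$ separating $C_1,\dots,C_t$. $C(N,q,\{w_1,\ldots,w_t\})$ denotes the maximum $n$ for which an $SHF(N;n,q,\{w_1,\ldots,w_t\})$ exists. *)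

theory Defs
  imports
    Complex_Main
    "HOL-Library.FuncSet"
    "HOL-Library.Disjoint_Sets"
    "HOL-Number_Theory.Cong"
begin

text \<open>Functions \<open>X \<rightarrow> Y\<close> are taken from the extensional function space, so that
  \<open>card F\<close> counts functions on \<open>X\<close>, irrespective of values outside \<open>X\<close>.\<close>

definition hash_family ::
    "nat \<Rightarrow> nat \<Rightarrow> nat \<Rightarrow> 'a set \<Rightarrow> 'b set \<Rightarrow> ('a \<Rightarrow> 'b) set \<Rightarrow> bool" where
  "hash_family N n q X Y F \<longleftrightarrow>
     finite X \<and> card X = n \<and> finite Y \<and> card Y = q \<and> F \<subseteq> X \<rightarrow>\<^sub>E Y \<and> card F = N"

definition separates :: "('a \<Rightarrow> 'b) \<Rightarrow> nat \<Rightarrow> (nat \<Rightarrow> 'a set) \<Rightarrow> bool" where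
  "separates f t C \<longleftrightarrow> disjoint_family_on (\<lambda>i. f ` C i) {1..t}"

text \<open>The type \<open>{w\<^sub>1, \<dots>, w\<^sub>t}\<close> is given by \<open>t\<close> and the values of \<open>w\<close> on \<open>{1..t}\<close>.\<close>

definition SHF ::
    "nat \<Rightarrow> nat \<Rightarrow> nat \<Rightarrow> nat \<Rightarrow> (nat \<Rightarrow> nat) \<Rightarrow> 'a set \<Rightarrow> 'b set \<Rightarrow> ('a \<Rightarrow> 'b) set \<Rightarrow> bool" where
  "SHF N n q t w X Y F \<longleftrightarrow>
     hash_family N n q X Y F \<and>
     (\<forall>C. (\<forall>i\<in>{1..t}. C i \<subseteq> X \<and> card (C i) = w i) \<and> disjoint_family_on C {1..t}
        \<longrightarrow> (\<exists>f\<in>F. separates f t C))"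

text \<open>All sets involved are finite, so the existence of an \<open>SHF\<close> with given parameters may be
  tested on sets of natural numbers. If \<open>2 \<le> t \<le> q\<close> and all \<open>w\<^sub>i\<close> are positive, the set below is
  nonempty and finite, hence \<open>Max\<close> is the genuine maximum.\<close>

definition max_SHF :: "nat \<Rightarrow> nat \<Rightarrow> nat \<Rightarrow> (nat \<Rightarrow> nat) \<Rightarrow> nat" where
  "max_SHF N q t w =
     Max {n. \<exists>(X :: nat set) (Y :: nat set) F. SHF N n q t w X Y F}"

end

theory Submission
  imports Defs
begin

text \<open>
  Split the \<open>N\<close> functions into \<open>u - 1\<close> blocks, \<open>r\<close> of them of size \<open>\<lceil>N/(u-1)\<rceil>\<close> and the others of
  size \<open>\<lfloor>N/(u-1)\<rfloor>\<close>. A block \<open>B\<close> admits a set of at most \<open>q ^ |B|\<close> points representing all value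
  patterns on \<open>B\<close>. Remove such sets of representatives one block after the other. If \<open>n\<close> exceeds
  the bound, a point survives, and reading the removals backwards one can grow a tree on \<open>u\<close> distinct
  points from it: the point added for a block \<open>B\<close> may be chosen to agree on \<open>B\<close> with any point already
  in the tree. Given any colouring of the \<open>u\<close> tree points with class sizes \<open>w\<^sub>1, \<dots>, w\<^sub>t\<close> in which the
  first two points differ, every further point can thus be attached to one of a different colour,
  so that no function separates the colour classes.
\<close>

text \<open>Transport the first projection of the disjoint union of the sets \<open>{..<s i}\<close>
  along a bijection from \<open>S\<close>. This serves twice: to colour the tree points and to cut
  \<open>F\<close> into blocks of given sizes.\<close>

lemma ex_map_card_fibres:
  fixes s :: "'i \<Rightarrow> nat"
  assumes "finite I" "finite S" "(\<Sum>i\<in>I. s i) = card S"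
  obtains c where "c \<in> S \<rightarrow> I" "\<And>i. i \<in> I \<Longrightarrow> card {x \<in> S. c x = i} = s i"
proof -
  let ?T = "Sigma I (\<lambda>i. {..<s i})"
  have "finite ?T" "card S = card ?T" using assms by auto
  then obtain b where b: "bij_betw b S ?T"
    using finite_same_card_bij[OF \<open>finite S\<close>] by blast
  have "fst \<circ> b \<in> S \<rightarrow> I" using bij_betwE[OF b] by fastforce
  moreover have "card {x \<in> S. (fst \<circ> b) x = i} = s i" if "i \<in> I" for i
  proof -
    have "b ` {x \<in> S. fst (b x) = i} = {y \<in> b ` S. fst y = i}" by auto
    also have "\<dots> = {i} \<times> {..<s i}" using that unfolding bij_betw_imp_surj_on[OF b] by auto
    finally have "b ` {x \<in> S. fst (b x) = i} = {i} \<times> {..<s i}" .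
    moreover have "inj_on b {x \<in> S. fst (b x) = i}"
      using bij_betw_imp_inj_on[OF b] by (rule inj_on_subset) auto
    ultimately have "card {x \<in> S. fst (b x) = i} = card ({i} \<times> {..<s i})"
      using card_image by fastforce
    then show ?thesis by simp
  qed
  ultimately show thesis by (rule that)
qed

text \<open>Colours 1 and 2 are reserved for the points 0 and 1, which is possible as
  \<open>t \<ge> 2\<close> and all class sizes are positive. The remaining \<open>u - 2\<close>
  points are distributed according to the reduced sizes \<open>w'\<close>.\<close>

lemma ex_colouring_card_fibres:
  fixes w :: "nat \<Rightarrow> nat"
  assumes "t \<ge> 2" and pos: "\<forall>i\<in>{1..t}. w i \<ge> 1"
  obtains c where "c \<in> {..<\<Sum>i=1..t. w i} \<rightarrow> {1..t}" "c 0 \<noteq> c (1::nat)"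
    "\<And>i. i \<in> {1..t} \<Longrightarrow> card {a \<in> {..<\<Sum>i=1..t. w i}. c a = i} = w i"
proof -
  define u where "u = (\<Sum>i=1..t. w i)"
  define w' where "w' i = w i - (if i \<in> {1,2} then 1 else 0)" for i
  have w: "w i = w' i + (if i \<in> {1,2} then 1 else 0)" if "i \<in> {1..t}" for i
    using pos that by (auto simp: w'_def)
  have "u = (\<Sum>i=1..t. w' i + (if i \<in> {1,2} then 1 else 0))"
    unfolding u_def by (rule sum.cong[OF refl], rule w)
  also have "\<dots> = (\<Sum>i=1..t. w' i) + card ({1..t} \<inter> {1,2})"
    by (subst sum.distrib) (simp only: card_eq_sum sum.inter_restrict[OF finite_atLeastAtMost])
  also have "{1..t} \<inter> {1,2} = {1,2::nat}" using \<open>t \<ge> 2\<close> by auto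
  finally have u: "u = (\<Sum>i=1..t. w' i) + 2" by simp
  then have "(\<Sum>i=1..t. w' i) = card {2..<u}" by simp
  then obtain d where d: "d \<in> {2..<u} \<rightarrow> {1..t}"
      "\<And>i. i \<in> {1..t} \<Longrightarrow> card {x \<in> {2..<u}. d x = i} = w' i"
    using ex_map_card_fibres[of "{1..t}" "{2..<u}" w'] by auto
  define c where "c = d(0 := 1, 1 := 2)"
  have "c \<in> {..<u} \<rightarrow> {1..t}" using d(1) \<open>t \<ge> 2\<close> by (auto simp: c_def Pi_iff)
  moreover have "c 0 \<noteq> c 1" by (simp add: c_def)
  moreover have "card {a \<in> {..<u}. c a = i} = w i" if i: "i \<in> {1..t}" for i
  proof -
    have "{a \<in> {..<u}. c a = i} =
        {x \<in> {2..<u}. d x = i} \<union> (if i = 1 then {0} else if i = 2 then {1} else {})"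
      using u by (auto simp: c_def split: if_splits)
    then have "card {a \<in> {..<u}. c a = i} =
        card {x \<in> {2..<u}. d x = i} + card (if i = 1 then {0} else if i = 2 then {1::nat} else {})"
      by (simp only:) (rule card_Un_disjoint, auto split: if_splits)
    then show ?thesis using d(2)[OF i] w[OF i] by (auto split: if_splits)
  qed
  ultimately show thesis using that unfolding u_def by blast
qed

lemma ex_pattern_representatives:
  fixes B :: "('a \<Rightarrow> 'b) set"
  assumes "finite X" "finite Y" "finite B" "B \<subseteq> X \<rightarrow> Y"
  obtains U where "U \<subseteq> X" "card U \<le> card Y ^ card B"
    "\<And>x. x \<in> X \<Longrightarrow> \<exists>y\<in>U. \<forall>f\<in>B. f y = f x"
proof -
  \<comment> \<open>\<open>\<phi> x\<close> is the pattern of \<open>x\<close> on \<open>B\<close>.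
    Being extensional, it lies in a function space with \<open>card Y ^ card B\<close> elements;
    \<open>U\<close> takes one point from each fibre of \<open>\<phi>\<close>.\<close>
  define \<phi> where "\<phi> x = (\<lambda>f\<in>B. f x)" for x :: 'a
  define U where "U = inv_into X \<phi> ` \<phi> ` X"
  have "\<phi> ` X \<subseteq> B \<rightarrow>\<^sub>E Y" using assms(4) by (fastforce simp: \<phi>_def)
  then have "card (\<phi> ` X) \<le> card (B \<rightarrow>\<^sub>E Y)"
    using assms(2,3) by (intro card_mono finite_PiE) auto
  also have "\<dots> = card Y ^ card B" using \<open>finite B\<close> by (simp add: card_PiE)
  finally have "card (\<phi> ` X) \<le> card Y ^ card B" .
  moreover have "card U \<le> card (\<phi> ` X)"
    unfolding U_def using \<open>finite X\<close> by (intro card_image_le) auto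
  moreover have "U \<subseteq> X" by (auto simp: U_def inv_into_into)
  moreover have "\<exists>y\<in>U. \<forall>f\<in>B. f y = f x" if "x \<in> X" for x
  proof
    show "inv_into X \<phi> (\<phi> x) \<in> U" using that by (simp add: U_def)
    have "\<phi> (inv_into X \<phi> (\<phi> x)) = \<phi> x" using that by (simp add: f_inv_into_f)
    then have "\<phi> (inv_into X \<phi> (\<phi> x)) f = \<phi> x f" for f by simp
    moreover have "\<phi> y f = f y" if "f \<in> B" for y f using that by (simp add: \<phi>_def)
    ultimately show "\<forall>f\<in>B. f (inv_into X \<phi> (\<phi> x)) = f x" by metis
  qed
  ultimately show thesis using that by (meson le_trans)
qed

text \<open>Here \<open>h\<close> is the parent map: point \<open>Suc j\<close> hangs from the
  earlier point \<open>h j\<close>, and block \<open>B j\<close> does not tell the two apart. The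
  induction peels off the last block, so \<open>X\<close> shrinks and must stay general.\<close>

lemma ex_agreement_tree:
  fixes B :: "nat \<Rightarrow> ('a \<Rightarrow> 'b) set"
  assumes "finite Y" "\<And>j. j < k \<Longrightarrow> h j \<le> j"
    and "finite X" "\<And>j. j < k \<Longrightarrow> finite (B j)" "\<And>j. j < k \<Longrightarrow> B j \<subseteq> X \<rightarrow> Y"
    and "(\<Sum>j<k. card Y ^ card (B j)) < card X"
  shows "\<exists>p. inj_on p {..k} \<and> p ` {..k} \<subseteq> X \<and> (\<forall>j<k. \<forall>f\<in>B j. f (p (Suc j)) = f (p (h j)))"
  using assms(2-)
proof (induction k arbitrary: X)
  case 0
  then obtain x where "x \<in> X" by (auto simp: card_gt_0_iff)
  then show ?case by (intro exI[of _ "\<lambda>_. x"]) auto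
next
  case (Suc k)
  obtain U where U: "U \<subseteq> X" "card U \<le> card Y ^ card (B k)"
      "\<And>x. x \<in> X \<Longrightarrow> \<exists>y\<in>U. \<forall>f\<in>B k. f y = f x"
    using ex_pattern_representatives[OF \<open>finite X\<close> \<open>finite Y\<close>, of "B k"] Suc.prems(3,4) by blast
  \<comment> \<open>Deleting \<open>U\<close> costs at most the last summand of the bound, so the
    strict inequality passes to the remaining blocks.\<close>
  have "card (X - U) = card X - card U"
    using U(1) \<open>finite X\<close> by (simp add: card_Diff_subset finite_subset)
  then have card: "(\<Sum>j<k. card Y ^ card (B j)) < card (X - U)" using Suc.prems(5) U(2) by simp
  have "B j \<subseteq> (X - U) \<rightarrow> Y" if "j < k" for j using Suc.prems(4)[of j] that by auto
  then obtain p where p: "inj_on p {..k}" "p ` {..k} \<subseteq> X - U"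
      "\<And>j f. j < k \<Longrightarrow> f \<in> B j \<Longrightarrow> f (p (Suc j)) = f (p (h j))"
    using Suc.IH[of "X - U"] Suc.prems(1-3) card by (auto simp: less_Suc_eq)
  have hk: "h k \<le> k" using Suc.prems(1) by simp
  then have "p (h k) \<in> X" using p(2) by auto
  then obtain y where y: "y \<in> U" "\<And>f. f \<in> B k \<Longrightarrow> f y = f (p (h k))" using U(3) by blast
  \<comment> \<open>The new point lies in \<open>U\<close> and the old ones avoid \<open>U\<close>,
    which gives injectivity. Parents have index at most \<open>k\<close>, so the update leaves them
    unchanged.\<close>
  let ?p = "p(Suc k := y)"
  have "?p ` {..Suc k} \<subseteq> X" using p(2) y(1) U(1) by (auto simp: atMost_Suc)
  moreover have "inj_on ?p {..Suc k}"
    using p(1,2) y(1) by (auto simp: atMost_Suc inj_on_def)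
  moreover have "f (?p (Suc j)) = f (?p (h j))" if "j < Suc k" "f \<in> B j" for j f
  proof -
    have "h j < Suc k" using Suc.prems(1)[of j] that by simp
    then show ?thesis using p(3) y(2) that by (auto simp: less_Suc_eq)
  qed
  ultimately show ?case by blast
qed

lemma SHF_card_le_sum_blocks:
  fixes B :: "nat \<Rightarrow> ('a \<Rightarrow> 'b) set"
  assumes "t \<ge> 2" "\<forall>i\<in>{1..t}. w i \<ge> 1" and u: "u = (\<Sum>i=1..t. w i)"
    and shf: "SHF N n q t w X Y F" and "finite F" and B: "F = (\<Union>j<u - 1. B j)"
  shows "n \<le> (\<Sum>j<u - 1. q ^ card (B j))"
proof (rule ccontr)
  assume "\<not> ?thesis"
  moreover have X: "finite X" "card X = n" "finite Y" "card Y = q" "F \<subseteq> X \<rightarrow>\<^sub>E Y"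
    using shf by (auto simp: SHF_def hash_family_def)
  ultimately have less: "(\<Sum>j<u - 1. card Y ^ card (B j)) < card X" by simp
  obtain c where c: "c \<in> {..<u} \<rightarrow> {1..t}" "c 0 \<noteq> c (1::nat)"
      "\<And>i. i \<in> {1..t} \<Longrightarrow> card {a \<in> {..<u}. c a = i} = w i"
    using ex_colouring_card_fibres assms(1,2) unfolding u by blast
  \<comment> \<open>Since points 0 and 1 differ in colour, one of them can always be a parent of a
    different colour. For \<open>j = 0\<close> this is point 0, whence
    \<open>h j \<le> j\<close>.\<close>
  define h where "h j = (if c (Suc j) = c 0 then 1 else 0 :: nat)" for j
  have h: "h j \<le> j" "c (Suc j) \<noteq> c (h j)" for j
    using c(2) by (cases j; auto simp: h_def)+
  have BF: "B j \<subseteq> F" if "j < u - 1" for j using that B by blast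
  then have "B j \<subseteq> X \<rightarrow> Y" if "j < u - 1" for j
    using X(5) that by (fastforce simp: PiE_def)
  moreover have "finite (B j)" if "j < u - 1" for j
    using BF[OF that] \<open>finite F\<close> by (rule finite_subset)
  ultimately obtain p where p: "inj_on p {..u - 1}" "p ` {..u - 1} \<subseteq> X"
      "\<And>j f. j < u - 1 \<Longrightarrow> f \<in> B j \<Longrightarrow> f (p (Suc j)) = f (p (h j))"
    using ex_agreement_tree[OF X(3) h(1) X(1) _ _ less] by auto
  define C where "C i = p ` {a \<in> {..<u}. c a = i}" for i
  have lt: "{..<u} \<subseteq> {..u - 1}" by auto
  have "C i \<subseteq> X" for i using p(2) by (auto simp: C_def)
  moreover have "card (C i) = w i" if "i \<in> {1..t}" for i
  proof -
    have "inj_on p {a \<in> {..<u}. c a = i}" using p(1) by (rule inj_on_subset) auto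
    then show ?thesis using c(3)[OF that] by (simp add: C_def card_image)
  qed
  moreover have "disjoint_family_on C {1..t}"
    using inj_on_subset[OF p(1) lt] by (auto simp: C_def disjoint_family_on_def inj_on_def)
  ultimately obtain f where "f \<in> F" and sep: "separates f t C"
    using shf unfolding SHF_def by blast
  \<comment> \<open>The block containing \<open>f\<close> yields an edge of the tree whose ends have
    different colours but equal values under \<open>f\<close>.\<close>
  then obtain j where j: "j < u - 1" "f \<in> B j" using B by blast
  have ran: "Suc j < u" "h j < u" using j h(1)[of j] by linarith+
  then have "c (Suc j) \<in> {1..t}" "c (h j) \<in> {1..t}" using c(1) by auto
  with sep h(2)[of j] have "f ` C (c (Suc j)) \<inter> f ` C (c (h j)) = {}"
    unfolding separates_def disjoint_family_on_def by blast
  moreover have "f (p (Suc j)) \<in> f ` C (c (Suc j))" "f (p (h j)) \<in> f ` C (c (h j))"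
    using ran by (auto simp: C_def)
  ultimately show False using p(3)[OF j] by auto
qed

theorem theorem1p6:
  fixes N n q t u r :: nat and w :: "nat \<Rightarrow> nat"
    and X :: "'a set" and Y :: "'b set" and F :: "('a \<Rightarrow> 'b) set"
  assumes "N \<ge> 2" and "q \<ge> 2" and "t \<ge> 2"
    and "\<forall>i\<in>{1..t}. w i \<ge> 1"
    and "q \<ge> t"
    and "u = (\<Sum>i=1..t. w i)"
    and "1 \<le> r" and "r \<le> u - 1" and "[N = r] (mod (u - 1))"
    and "SHF N n q t w X Y F"
    and "max_SHF (nat \<lfloor>real N / real (u - 1)\<rfloor>) q t w \<ge> u"
  shows "n \<le> r * q ^ nat \<lceil>real N / real (u - 1)\<rceil>
              + (u - 1 - r) * q ^ nat \<lfloor>real N / real (u - 1)\<rfloor>"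
proof -
  define m where "m = u - 1"
  define lo where "lo = nat \<lfloor>real N / real m\<rfloor>"
  define hi where "hi = nat \<lceil>real N / real m\<rceil>"
  have m: "m > 0" "r \<le> m" using assms(7,8) by (auto simp: m_def)
  have lo: "lo = N div m" by (simp add: lo_def floor_divide_of_nat_eq)
  have N: "r * hi + (m - r) * lo = N"
  proof (cases "r = m")
    \<comment> \<open>Remainder 0 is represented by \<open>r = m\<close>; then \<open>m\<close>
      divides \<open>N\<close>, and floor and ceiling coincide.\<close>
    case True
    then have "N mod m = 0" using assms(9) by (simp add: cong_def m_def)
    then have "N = m * lo" by (auto simp: lo)
    moreover from this have "hi = lo" using m by (simp add: hi_def)
    ultimately show ?thesis using True by simp
  next
    case False
    then have "N mod m = r" using assms(9) m by (simp add: cong_def m_def)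
    then have N: "N = m * lo + r" by (metis lo mult_div_mod_eq)
    have "\<lceil>real N / real m\<rceil> = int lo + 1"
    proof (rule ceiling_unique)
      show "real_of_int (int lo + 1) - 1 < real N / real m"
        using m assms(7) by (simp add: N field_simps)
      show "real N / real m \<le> real_of_int (int lo + 1)"
        using m by (simp add: N field_simps)
    qed
    then have "hi = lo + 1" by (simp add: hi_def)
    then have "r * hi + (m - r) * lo = (r + (m - r)) * lo + r" by (simp add: algebra_simps)
    then show ?thesis using N m by simp
  qed
  define s where "s j = (if j < r then hi else lo)" for j
  \<comment> \<open>Taken with \<open>g\<close> the identity, this shows that the block sizes add up
    to \<open>N\<close>; with \<open>g\<close> the power of \<open>q\<close>, it gives the final
    bound.\<close>
  have sum_s: "(\<Sum>j<m. g (s j)) = r * g hi + (m - r) * g lo" for g :: "nat \<Rightarrow> nat"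
  proof -
    have "(\<Sum>j<m. g (s j)) = (\<Sum>j<r. g (s j)) + (\<Sum>j=r..<m. g (s j))"
      using m sum.atLeastLessThan_concat[of 0 r m "\<lambda>j. g (s j)"] by (simp add: lessThan_atLeast0)
    then show ?thesis by (simp add: s_def)
  qed
  have F: "card F = N" using assms(10) by (auto simp: SHF_def hash_family_def)
  \<comment> \<open>An infinite set has \<open>card\<close> 0, so \<open>N > 0\<close> forces
    finiteness.\<close>
  then have fin: "finite F" using assms(1) by (auto intro: card_ge_0_finite)
  have "(\<Sum>j<m. s j) = card F" using sum_s[of "\<lambda>x. x"] N F by simp
  then obtain c where c: "c \<in> F \<rightarrow> {..<m}" "\<And>j. j \<in> {..<m} \<Longrightarrow> card {f \<in> F. c f = j} = s j"
    using ex_map_card_fibres[of "{..<m}" F s] fin by auto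
  have "F = (\<Union>j<u - 1. {f \<in> F. c f = j})" using c(1) by (auto simp: m_def)
  then have "n \<le> (\<Sum>j<u - 1. q ^ card {f \<in> F. c f = j})"
    by (rule SHF_card_le_sum_blocks[OF assms(3,4,6,10) fin])
  also have "\<dots> = (\<Sum>j<m. q ^ s j)" using c(2) by (simp add: m_def)
  also have "\<dots> = r * q ^ hi + (m - r) * q ^ lo" by (rule sum_s)
  finally show ?thesis by (simp add: hi_def lo_def m_def)
qed

end
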